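(* Let $\ell\in N$, let $S\subseteq[\ell]$ and $\bar S=[\ell]\setminus S$. For every $i\in(\bar S\setminus\{1\})\cup\{\ell+1\}$ let $T_{i-1}=\{t_{i-1(1)},t_{i-1(2)},\dots,t_{i-1(a_{i-1})}\}\subseteq T^*_{i-1}$ be a set of $a_{i-1}$ scenarios indexed so that $D_{t_{i-1(1)}}\ge D_{t_{i-1(2)}}\ge\cdots\ge D_{t_{i-1(a_{i-1})}}$, and put $t_{i-1(a_{i-1}+1)}=\sigma_{i-1(k+1)}$. In addition, fix $t_{\ell(1)}=\sigma_{\ell(1)}$. Let $\bar T=\big(\bigcup_{i\in\bar S}T_{i-1}\big)\cup T_\ell$. For $j\in\bar T$ and for an index $i$ with $i=\ell$ or $i+1\in\bar S$ define $$\alpha_{ji}=\begin{cases}0,&\text{if } i=\ell,\ j\notin T_\ell,\ \text{or if } i+1\in\bar S,\ j\notin T_i,\\ D_{t_{\ell(p)}}-D_{t_{\ell(p+1)}},&\text{if } i=\ell,\ j=t_{\ell(p)}\in T_\ell\text{ for some }p\in[a_\ell],\\ D_{t_{i(p)}}-D_{t_{i(p+1)}},&\text{if } i+1\in\bar S,\ j=t_{i(p)}\in T_i\text{ for some }p\in[a_i],\end{cases}$$ and let $\bar\alpha_j=\max\big\{\max_{i\in\bar S}\{\alpha_{j(i-1)}\},\ \alpha_{j\ell}\big\}$ for $j\in\bar T$. Then the inequality $$\sum_{i\in S}y_i+\sum_{i\in\bar S}\big(D_{t_{\ell(1)}}-D_{t_{i-1(1)}}\big)x_i+\sum_{j\in\bar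 T}\bar\alpha_j z_j\ \ge\ D_{t_{\ell(1)}}$$ is valid for $P$, i.e. it is satisfied by every $(\mathbf x,\mathbf y,\mathbf z)\in P$.
   Context: For a positive integer $r$, $[r]=\{1,\dots,r\}$. $N=\{1,\dots,n\}$ is the set of time periods and $\Omega=\{1,\dots,m\}$ is the set of scenarios, all with probability $1/m$. $d_{ji}\ge 0$ is the demand in period $i$ under scenario $j$; $0\le\epsilon<1$ is a given risk level and $k=\lfloor m\epsilon\rfloor$. $M_i=\max_{j\in\Omega}\sum_{p=i}^n d_{jp}$ for $i\in N$. The set $P$ is the set of all $(\mathbf x,\mathbf y,\mathbf z)\in\{0,1\}^n\times\mathbb R_+^n\times\{0,1\}^m$ satisfying $\sum_{i=1}^t y_i\ge\sum_{i=1}^t d_{ji}(1-z_j)$ for all $t\in N,\ j\in\Omega$; $\ \sum_{j=1}^m z_j\le k$; $\ y_i\le M_ix_i$ for all $i\in N$. Cumulative demands: $D_{ji}=\sum_{p=1}^i d_{jp}$. For each $i\in N$, $\sigma_{i(1)},\dots,\sigma_{i(m)}$ is a fixed ordering of the scenarios with $D_{\sigma_{i(1)}i}\ge D_{\sigma_{i(2)}i}\ge\cdots\ge D_{\sigma_{i(m)}i}$, and $T_i^*=\{\sigma_{i(1)},\dots,\sigma_{i(k)}\}$. For scenarios written as $\sigma_{i(p)}$ or $t_{i(p)}$ the period index is dropped from the cumulative demand: $D_{\sigma_{i(p)}}=D_{\sigma_{i(p)}i}$ and $D_{t_{i(p)}}=D_{t_{i(p)}i}$. If $T_i=\emptyset$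 then $a_i=0$ and $t_{i(1)}=\sigma_{i(k+1)}$. Convention for period $0$ (relevant when $1\in\bar S$): $T_0=\emptyset$ and $D_{t_{0(1)}}=0$, $\alpha_{j0}=0$ for all $j$. *)

theory Defs
  imports Complex_Main "HOL-Library.FuncSet"
begin

text \<open>Demand in period \<open>i\<close> under scenario \<open>j\<close> is written \<open>d j i\<close>; the periods are \<open>{1..n}\<close> and
  the scenarios \<open>{1..m}\<close>.\<close>

text \<open>For \<open>i = 0\<close> the sum is empty, so the cumulative demand of every scenario in period \<open>0\<close> is \<open>0\<close>.\<close>

definition cum_demand :: "(nat \<Rightarrow> nat \<Rightarrow> real) \<Rightarrow> nat \<Rightarrow> nat \<Rightarrow> real" where
  "cum_demand d j i = (\<Sum>p = 1..i. d j p)"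

definition big_M :: "nat \<Rightarrow> nat \<Rightarrow> (nat \<Rightarrow> nat \<Rightarrow> real) \<Rightarrow> nat \<Rightarrow> real" where
  "big_M n m d i = Max ((\<lambda>j. \<Sum>p = i..n. d j p) ` {1..m})"

text \<open>Vectors are extensional functions on their index sets, so that distinct elements of the set
  differ inside the index range.\<close>

definition lot_sizing_set ::
  "nat \<Rightarrow> nat \<Rightarrow> nat \<Rightarrow> (nat \<Rightarrow> nat \<Rightarrow> real) \<Rightarrow> ((nat \<Rightarrow> real) \<times> (nat \<Rightarrow> real) \<times> (nat \<Rightarrow> real)) set"
  where
  "lot_sizing_set n m k d =
    {(x, y, z). x \<in> {1..n} \<rightarrow>\<^sub>E {0, 1} \<and> y \<in> {1..n} \<rightarrow>\<^sub>E {0..} \<and> z \<in> {1..m} \<rightarrow>\<^sub>E {0, 1} \<and>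
      (\<forall>t\<in>{1..n}. \<forall>j\<in>{1..m}. (\<Sum>i = 1..t. y i) \<ge> (\<Sum>i = 1..t. d j i * (1 - z j))) \<and>
      (\<Sum>j = 1..m. z j) \<le> real k \<and>
      (\<forall>i\<in>{1..n}. y i \<le> big_M n m d i * x i)}"

text \<open>\<open>e 1, \<dots>, e r\<close> lists the scenarios in \<open>A\<close> without repetition, by nonincreasing cumulative demand
  in period \<open>i\<close>.\<close>

definition demand_ordering ::
  "(nat \<Rightarrow> nat \<Rightarrow> real) \<Rightarrow> nat \<Rightarrow> nat \<Rightarrow> (nat \<Rightarrow> nat) \<Rightarrow> nat set \<Rightarrow> bool" where
  "demand_ordering d i r e A \<longleftrightarrow>
    bij_betw e {1..r} A \<and>
    (\<forall>p q. 1 \<le> p \<and> p \<le> q \<and> q \<le> r \<longrightarrow> cum_demand d (e p) i \<ge> cum_demand d (e q) i)"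

definition top_scenarios :: "(nat \<Rightarrow> nat \<Rightarrow> nat) \<Rightarrow> nat \<Rightarrow> nat \<Rightarrow> nat set" where
  "top_scenarios \<sigma> k i = \<sigma> i ` {1..k}"

text \<open>The sets \<open>T i\<close> are listed as \<open>t i 1, \<dots>, t i (a i)\<close>, so \<open>inv_into {1..a i} (t i) j\<close> is the
  position of \<open>j \<in> T i\<close> in that list.\<close>

definition alpha ::
  "(nat \<Rightarrow> nat \<Rightarrow> real) \<Rightarrow> (nat \<Rightarrow> nat set) \<Rightarrow> (nat \<Rightarrow> nat) \<Rightarrow> (nat \<Rightarrow> nat \<Rightarrow> nat) \<Rightarrow> nat \<Rightarrow> nat \<Rightarrow> real"
  where
  "alpha d T a t j i =
    (if j \<in> T i
     then let p = inv_into {1..a i} (t i) j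
          in cum_demand d (t i p) i - cum_demand d (t i (p + 1)) i
     else 0)"

text \<open>One maximum over a nonempty set, so that an empty \<open>Sbar\<close> contributes nothing.\<close>

definition alpha_bar ::
  "(nat \<Rightarrow> nat \<Rightarrow> real) \<Rightarrow> (nat \<Rightarrow> nat set) \<Rightarrow> (nat \<Rightarrow> nat) \<Rightarrow> (nat \<Rightarrow> nat \<Rightarrow> nat) \<Rightarrow>
    nat set \<Rightarrow> nat \<Rightarrow> nat \<Rightarrow> real" where
  "alpha_bar d T a t Sbar l j =
    Max ((\<lambda>i. alpha d T a t j (i - 1)) ` Sbar \<union> {alpha d T a t j l})"

end

theory Submission imports Defs begin

text \<open>If \<open>x\<close> vanishes on \<open>Sbar\<close>, put \<open>s = l\<close>; otherwise let \<open>s + 1\<close> be the first period of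
  \<open>Sbar\<close> at which it does not, so that the \<open>x\<close>-terms contribute at least the difference of the
  leading demands in periods \<open>l\<close> and \<open>s\<close>. Up to period \<open>s\<close> only the periods of \<open>S\<close> produce, hence
  they cover the demand up to \<open>s\<close> of every scenario \<open>j\<close> with \<open>z j = 0\<close>. Walk down the list \<open>t s\<close>
  to the first scenario with \<open>z = 0\<close> (if there is none, one exists among the \<open>k + 1\<close> largest,
  because at most \<open>k\<close> scenarios have \<open>z = 1\<close>): the drops in demand met on the way telescope, and
  the \<open>z\<close>-terms pay for them.\<close>

section \<open>Listings of scenarios by cumulative demand\<close>

lemma demand_orderingD:
  assumes "demand_ordering d i r e A" "1 \<le> p" "p \<le> r"
  shows "e p \<in> A"
  using assms unfolding demand_ordering_def by (auto dest: bij_betwE)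

lemma demand_ordering_mono:
  assumes "demand_ordering d i r e A" "1 \<le> p" "p \<le> q" "q \<le> r"
  shows "cum_demand d (e q) i \<le> cum_demand d (e p) i"
  using assms unfolding demand_ordering_def by blast

lemma demand_ordering_first:
  assumes "demand_ordering d i r e A" "j \<in> A"
  shows "cum_demand d j i \<le> cum_demand d (e 1) i"
proof -
  obtain p where "1 \<le> p" "p \<le> r" "e p = j"
    using assms unfolding demand_ordering_def bij_betw_def by force
  then show ?thesis
    using demand_ordering_mono[OF assms(1), of 1 p] by auto
qed

lemma cum_demand_mono:
  assumes "\<And>p. i < p \<Longrightarrow> p \<le> l \<Longrightarrow> 0 \<le> d j p" "i \<le> l"
  shows "cum_demand d j i \<le> cum_demand d j l"
  unfolding cum_demand_def using assms by (intro sum_mono2) auto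

text \<open>The entry \<open>e (r + 1)\<close> closing the list is \<open>s (k + 1)\<close>, and
  \<open>A\<close> holds only scenarios from the first \<open>k\<close> positions of
  \<open>s\<close>; so the demands stay nonincreasing when the list is extended by this
  entry.\<close>

lemma list_drop_nonneg:
  assumes ord: "demand_ordering d i m s B" and km: "k < m"
    and sub: "A \<subseteq> s ` {1..k}" and ordA: "demand_ordering d i r e A"
    and last: "e (r + 1) = s (k + 1)" and p: "1 \<le> p" "p \<le> r"
  shows "cum_demand d (e (p + 1)) i \<le> cum_demand d (e p) i"
proof (cases "p = r")
  case True
  obtain q where q: "1 \<le> q" "q \<le> k" "e p = s q"
    using demand_orderingD[OF ordA p] sub by fastforce
  then show ?thesis
    using demand_ordering_mono[OF ord, of q "k + 1"] km last True by simp
next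
  case False
  then show ?thesis
    using demand_ordering_mono[OF ordA, of p "p + 1"] p by simp
qed

section \<open>The coefficients \<open>alpha\<close> and \<open>alpha_bar\<close>\<close>

lemma alpha_nonneg:
  assumes "demand_ordering d i m s B" "k < m" "T i \<subseteq> s ` {1..k}"
    and ordT: "demand_ordering d i (a i) (t i) (T i)" and "t i (a i + 1) = s (k + 1)"
  shows "0 \<le> alpha d T a t j i"
proof (cases "j \<in> T i")
  case True
  then have "j \<in> t i ` {1..a i}"
    using ordT by (simp add: demand_ordering_def bij_betw_def)
  then have "inv_into {1..a i} (t i) j \<in> {1..a i}"
    by (rule inv_into_into)
  then show ?thesis
    using list_drop_nonneg[OF assms] True by (simp add: alpha_def Let_def)
qed (simp add: alpha_def)

lemma alpha_list:
  assumes "demand_ordering d i (a i) (t i) (T i)" "1 \<le> p" "p \<le> a i"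
  shows "alpha d T a t (t i p) i = cum_demand d (t i p) i - cum_demand d (t i (p + 1)) i"
proof -
  have "inj_on (t i) {1..a i}"
    using assms(1) by (simp add: demand_ordering_def bij_betw_def)
  then have "inv_into {1..a i} (t i) (t i p) = p"
    using assms(2,3) by (simp add: inv_into_f_f)
  then show ?thesis
    using demand_orderingD[OF assms] by (simp add: alpha_def Let_def)
qed

lemma alpha_le_alpha_bar:
  assumes "finite Sbar" "i = l \<or> i + 1 \<in> Sbar"
  shows "alpha d T a t j i \<le> alpha_bar d T a t Sbar l j"
  unfolding alpha_bar_def using assms by (intro Max_ge) force+

section \<open>Finding a scenario with \<open>z j = 0\<close> and large demand\<close>

lemma unselected_scenario_exists:
  fixes z :: "nat \<Rightarrow> real"
  assumes ord: "demand_ordering d i m s {1..m}" and km: "k < m"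
    and z01: "\<And>j. j \<in> {1..m} \<Longrightarrow> z j \<in> {0, 1}" and zk: "(\<Sum>j = 1..m. z j) \<le> real k"
  obtains j where "j \<in> {1..m}" "z j = 0" "cum_demand d (s (k + 1)) i \<le> cum_demand d j i"
proof -
  \<comment> \<open>Pigeonhole: otherwise \<open>k + 1\<close> distinct scenarios have
    \<open>z = 1\<close>, and the sum of \<open>z\<close> exceeds \<open>k\<close>.\<close>
  have "\<exists>q\<in>{1..k + 1}. z (s q) = 0"
  proof (rule ccontr)
    assume none: "\<not> ?thesis"
    have bij: "inj_on s {1..m}" "s ` {1..m} = {1..m}"
      using ord by (simp_all add: demand_ordering_def bij_betw_def)
    have range: "s ` {1..k + 1} \<subseteq> {1..m}"
      using bij km by auto
    then have one: "z j = 1" if "j \<in> s ` {1..k + 1}" for j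
      using z01[of j] none that by blast
    have "card (s ` {1..k + 1}) = k + 1"
      using card_image[OF inj_on_subset[OF bij(1)], of "{1..k + 1}"] km by simp
    then have "real (k + 1) = sum z (s ` {1..k + 1})"
      using one by simp
    also have "\<dots> \<le> sum z {1..m}"
      using range z01 by (intro sum_mono2) force+
    finally show False
      using zk by simp
  qed
  then obtain q where q: "1 \<le> q" "q \<le> k + 1" "z (s q) = 0"
    by auto
  then show thesis
    using that[of "s q"] demand_orderingD[OF ord, of q] demand_ordering_mono[OF ord, of q "k + 1"] km
    by simp
qed

text \<open>\<open>\<beta>\<close> need only dominate the drops and \<open>B\<close> only contain
  the list, because \<open>alpha_bar\<close> is a maximum over several periods and
  \<open>Tbar\<close> a union of several lists. Nonnegativity of \<open>\<beta>\<close> makes the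
  surplus terms harmless.\<close>

lemma unselected_scenario_with_drop:
  fixes z \<beta> :: "nat \<Rightarrow> real"
  assumes ord: "demand_ordering d i m s {1..m}" and km: "k < m"
    and sub: "A \<subseteq> s ` {1..k}" and ordA: "demand_ordering d i r e A"
    and last: "e (r + 1) = s (k + 1)"
    and z01: "\<And>j. j \<in> {1..m} \<Longrightarrow> z j \<in> {0, 1}" and zk: "(\<Sum>j = 1..m. z j) \<le> real k"
    and B: "A \<subseteq> B" "B \<subseteq> {1..m}" and \<beta>0: "\<And>j. j \<in> B \<Longrightarrow> 0 \<le> \<beta> j"
    and \<beta>: "\<And>p. 1 \<le> p \<Longrightarrow> p \<le> r \<Longrightarrow> cum_demand d (e p) i - cum_demand d (e (p + 1)) i \<le> \<beta> (e p)"
  obtains j where "j \<in> {1..m}" "z j = 0"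
    "cum_demand d (e 1) i - cum_demand d j i \<le> (\<Sum>j\<in>B. \<beta> j * z j)"
proof -
  \<comment> \<open>The end of the walk; the alternative \<open>p = r + 1\<close> makes the least
    position exist even if all listed scenarios have \<open>z = 1\<close>.\<close>
  define p where "p = (LEAST p. 1 \<le> p \<and> (p = r + 1 \<or> z (e p) = 0))"
  have p: "1 \<le> p" "p = r + 1 \<or> z (e p) = 0"
    unfolding p_def using LeastI[of "\<lambda>p. 1 \<le> p \<and> (p = r + 1 \<or> z (e p) = 0)" "r + 1"] by auto
  have p_le: "p \<le> r + 1"
    unfolding p_def by (rule Least_le) simp
  have eB: "e q \<in> B" if "1 \<le> q" "q < p" for q
    using demand_orderingD[OF ordA, of q] that p_le B by auto
  have z1: "z (e q) = 1" if "1 \<le> q" "q < p" for q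
    using not_less_Least[of q "\<lambda>p. 1 \<le> p \<and> (p = r + 1 \<or> z (e p) = 0)"] that z01[of "e q"]
      eB[OF that] B unfolding p_def by auto
  have inj: "inj_on e {1..<p}"
    using ordA p_le unfolding demand_ordering_def bij_betw_def by (auto intro: inj_on_subset)
  have "cum_demand d (e 1) i - cum_demand d (e p) i
      = (\<Sum>q = 1..<p. cum_demand d (e q) i - cum_demand d (e (q + 1)) i)"
    \<comment> \<open>The library rule telescopes increments, hence the negated demand.\<close>
    using sum_Suc_diff'[of 1 p "\<lambda>q. - cum_demand d (e q) i"] p by simp
  also have "\<dots> \<le> (\<Sum>q = 1..<p. \<beta> (e q) * z (e q))"
    using \<beta> z1 p_le by (intro sum_mono) auto
  also have "\<dots> = (\<Sum>j\<in>e ` {1..<p}. \<beta> j * z j)"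
    by (subst sum.reindex[OF inj]) simp
  also have "\<dots> \<le> (\<Sum>j\<in>B. \<beta> j * z j)"
  proof (rule sum_mono2)
    show "finite B"
      using B(2) finite_subset by blast
    show "0 \<le> \<beta> j * z j" if "j \<in> B - e ` {1..<p}" for j
      using that \<beta>0[of j] z01[of j] subsetD[OF B(2), of j] by auto
  qed (use eB in auto)
  finally have drop: "cum_demand d (e 1) i - cum_demand d (e p) i \<le> (\<Sum>j\<in>B. \<beta> j * z j)" .
  show thesis
  proof (cases "p = r + 1")
    case True
    \<comment> \<open>The walk ended at \<open>s (k + 1)\<close>, which may itself have
      \<open>z = 1\<close>; it is replaced by a scenario of at least its demand.\<close>
    obtain j where "j \<in> {1..m}" "z j = 0" "cum_demand d (s (k + 1)) i \<le> cum_demand d j i"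
      using unselected_scenario_exists[OF ord km z01 zk] by blast
    then show thesis
      using that[of j] drop last True by simp
  next
    case False
    then have "e p \<in> {1..m}"
      using demand_orderingD[OF ordA, of p] p p_le B by auto
    then show thesis
      using that[of "e p"] drop p False by blast
  qed
qed

section \<open>Consequences of the constraints\<close>

lemma lot_sizing_setD:
  assumes "(x, y, z) \<in> lot_sizing_set n m k d"
  shows "\<And>i. i \<in> {1..n} \<Longrightarrow> x i \<in> {0, 1}"
    and "\<And>i. i \<in> {1..n} \<Longrightarrow> 0 \<le> y i"
    and "\<And>j. j \<in> {1..m} \<Longrightarrow> z j \<in> {0, 1}"
    and "(\<Sum>j = 1..m. z j) \<le> real k"
    and "\<And>i. i \<in> {1..n} \<Longrightarrow> x i = 0 \<Longrightarrow> y i = 0"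
    and "\<And>i j. i \<in> {1..n} \<Longrightarrow> j \<in> {1..m} \<Longrightarrow> z j = 0 \<Longrightarrow> cum_demand d j i \<le> (\<Sum>p = 1..i. y p)"
proof -
  show x: "x i \<in> {0, 1}" if "i \<in> {1..n}" for i
    using assms that unfolding lot_sizing_set_def by (auto dest: PiE_mem)
  show y: "0 \<le> y i" if "i \<in> {1..n}" for i
    using assms that unfolding lot_sizing_set_def by (auto dest: PiE_mem)
  show "z j \<in> {0, 1}" if "j \<in> {1..m}" for j
    using assms that unfolding lot_sizing_set_def by (auto dest: PiE_mem)
  show "(\<Sum>j = 1..m. z j) \<le> real k"
    using assms unfolding lot_sizing_set_def by auto
  show "y i = 0" if "i \<in> {1..n}" "x i = 0" for i
  proof -
    have "y i \<le> big_M n m d i * x i"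
      using assms that(1) unfolding lot_sizing_set_def by auto
    then show ?thesis
      using y[OF that(1)] that(2) by simp
  qed
  show "cum_demand d j i \<le> (\<Sum>p = 1..i. y p)" if "i \<in> {1..n}" "j \<in> {1..m}" "z j = 0" for i j
  proof -
    have "(\<Sum>p = 1..i. d j p * (1 - z j)) \<le> (\<Sum>p = 1..i. y p)"
      using assms that(1,2) unfolding lot_sizing_set_def by auto
    then show ?thesis
      using that(3) by (simp add: cum_demand_def)
  qed
qed

section \<open>Validity of the inequality\<close>

theorem proposition2:
  fixes n m k l :: nat
    and d :: "nat \<Rightarrow> nat \<Rightarrow> real"
    and \<epsilon> :: real
    and \<sigma> t :: "nat \<Rightarrow> nat \<Rightarrow> nat"
    and S Sbar Tbar :: "nat set"
    and T :: "nat \<Rightarrow> nat set"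
    and a :: "nat \<Rightarrow> nat"
  assumes "m \<ge> 1"
    and "\<forall>j\<in>{1..m}. \<forall>i\<in>{1..n}. d j i \<ge> 0"
    and "0 \<le> \<epsilon>" "\<epsilon> < 1"
    and "k = nat \<lfloor>real m * \<epsilon>\<rfloor>"
    and "\<forall>i\<in>{1..n}. demand_ordering d i m (\<sigma> i) {1..m}"
    and "l \<in> {1..n}"
    and "S \<subseteq> {1..l}"
    and "Sbar = {1..l} - S"
    and "\<forall>i \<in> (Sbar - {1}) \<union> {l + 1}.
           T (i - 1) \<subseteq> top_scenarios \<sigma> k (i - 1) \<and>
           demand_ordering d (i - 1) (a (i - 1)) (t (i - 1)) (T (i - 1)) \<and>
           t (i - 1) (a (i - 1) + 1) = \<sigma> (i - 1) (k + 1)"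
    and "T 0 = {}"
    and "t l 1 = \<sigma> l 1"
    and "Tbar = (\<Union>i\<in>Sbar. T (i - 1)) \<union> T l"
  shows "\<forall>(x, y, z) \<in> lot_sizing_set n m k d.
           (\<Sum>i\<in>S. y i)
           + (\<Sum>i\<in>Sbar. (cum_demand d (t l 1) l - cum_demand d (t (i - 1) 1) (i - 1)) * x i)
           + (\<Sum>j\<in>Tbar. alpha_bar d T a t Sbar l j * z j)
           \<ge> cum_demand d (t l 1) l"
proof clarify
  fix x y z
  assume P: "(x, y, z) \<in> lot_sizing_set n m k d"
  note PD = lot_sizing_setD[OF P]
  have ln: "1 \<le> l" "l \<le> n"
    using assms(7) by auto
  \<comment> \<open>Strictness makes position \<open>k + 1\<close>, where every list is closed, a
    position of a genuine scenario.\<close>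
  have km: "k < m"
  proof -
    have "real m * \<epsilon> < real m"
      using assms(1,4) by simp
    then have "\<lfloor>real m * \<epsilon>\<rfloor> < int m"
      by (simp add: floor_less_iff)
    then show ?thesis
      using assms(1,5) by linarith
  qed
  have Sbar: "finite Sbar" "Sbar \<subseteq> {1..l}" "S \<inter> Sbar = {}" "S \<union> Sbar = {1..l}" "finite S"
    using assms(8,9) finite_subset by auto
  \<comment> \<open>Reindexed by the period of the list instead of its successor;
    \<open>1 \<le> i\<close> matches the exclusion of 1 from \<open>Sbar\<close>.\<close>
  have listing: "demand_ordering d i m (\<sigma> i) {1..m} \<and> T i \<subseteq> \<sigma> i ` {1..k} \<and>
      demand_ordering d i (a i) (t i) (T i) \<and> t i (a i + 1) = \<sigma> i (k + 1)"
    if "1 \<le> i" "i = l \<or> i + 1 \<in> Sbar" for i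
  proof -
    have "i + 1 \<in> (Sbar - {1}) \<union> {l + 1}" "i \<in> {1..n}"
      using that ln Sbar(2) by auto
    then show ?thesis
      using bspec[OF assms(6), of i] bspec[OF assms(10), of "i + 1"] by (simp add: top_scenarios_def)
  qed
  have ordl: "demand_ordering d l m (\<sigma> l) {1..m}"
    using listing[of l] ln by simp
  have T_range: "T i \<subseteq> {1..m}" if i: "1 \<le> i" "i = l \<or> i + 1 \<in> Sbar" for i
  proof
    fix j assume "j \<in> T i"
    then obtain q where "1 \<le> q" "q \<le> k" "j = \<sigma> i q"
      using listing[OF i] by fastforce
    then show "j \<in> {1..m}"
      using demand_orderingD[of d i m "\<sigma> i" "{1..m}" q] listing[OF i] km by simp
  qed
  have Tbar_range: "Tbar \<subseteq> {1..m}"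
  proof
    fix j assume "j \<in> Tbar"
    then consider "j \<in> T l" | i where "i \<in> Sbar" "j \<in> T (i - 1)"
      unfolding assms(13) by blast
    then show "j \<in> {1..m}"
    proof cases
      case 1
      then show ?thesis using T_range[of l] ln by blast
    next
      case (2 i)
      \<comment> \<open>Period 0 occurs here if \<open>1 \<in> Sbar\<close>, but its list is
        empty.\<close>
      have "i - 1 \<noteq> 0"
        using 2(2) assms(11) by (metis empty_iff)
      then have "1 \<le> i - 1" "i - 1 + 1 \<in> Sbar"
        using 2(1) by simp_all
      then show ?thesis using T_range[of "i - 1"] 2(2) by blast
    qed
  qed
  have T_Tbar: "T i \<subseteq> Tbar" if "i = l \<or> i + 1 \<in> Sbar" for i
    using that unfolding assms(13) by force
  have first_range: "t i 1 \<in> {1..m}" if "1 \<le> i" "i = l \<or> i + 1 \<in> Sbar" for i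
  proof (cases "a i = 0")
    \<comment> \<open>An empty list begins with its closing entry
      \<open>\<sigma> i (k + 1)\<close>.\<close>
    case True
    then show ?thesis
      using listing[OF that] demand_orderingD[of d i m "\<sigma> i" "{1..m}" "k + 1"] km by simp
  next
    case False
    then show ?thesis
      using listing[OF that] T_range[OF that] demand_orderingD[of d i "a i" "t i" "T i" 1] by auto
  qed
  let ?\<beta> = "alpha_bar d T a t Sbar l"
  let ?Z = "\<Sum>j\<in>Tbar. ?\<beta> j * z j"
  let ?c = "\<lambda>i. cum_demand d (t l 1) l - cum_demand d (t (i - 1) 1) (i - 1)"
  \<comment> \<open>The maximum includes the value for period \<open>l\<close>, so nonnegativity of
    that one value suffices.\<close>
  have \<beta>0: "0 \<le> ?\<beta> j" for j
    using alpha_nonneg[of d l m "\<sigma> l" "{1..m}" k T a t j] listing[of l] ln km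
      alpha_le_alpha_bar[OF Sbar(1), of l l d T a t j] by auto
  have Z0: "0 \<le> ?Z"
    using \<beta>0 PD(3) Tbar_range by (intro sum_nonneg mult_nonneg_nonneg) force+
  have cover: "cum_demand d (t i 1) i \<le> (\<Sum>p = 1..i. y p) + ?Z"
    if i: "1 \<le> i" "i = l \<or> i + 1 \<in> Sbar" for i
  proof -
    have ord: "demand_ordering d i m (\<sigma> i) {1..m}" and sub: "T i \<subseteq> \<sigma> i ` {1..k}"
      and ordT: "demand_ordering d i (a i) (t i) (T i)" and last: "t i (a i + 1) = \<sigma> i (k + 1)"
      using listing[OF i] by auto
    have "cum_demand d (t i p) i - cum_demand d (t i (p + 1)) i \<le> ?\<beta> (t i p)"
      if "1 \<le> p" "p \<le> a i" for p
      using alpha_le_alpha_bar[OF Sbar(1) i(2), of d T a t "t i p"]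
        alpha_list[of d i a t T, OF ordT that] by simp
    \<comment> \<open>Taken with \<open>Tbar\<close> for \<open>B\<close> and
      \<open>alpha_bar\<close> for \<open>\<beta>\<close>, so the drops are bounded by the full
      \<open>z\<close>-sum \<open>?Z\<close>.\<close>
    from unselected_scenario_with_drop[OF ord km sub ordT last PD(3,4) T_Tbar[OF i(2)]
        Tbar_range \<beta>0 this]
    obtain j where j: "j \<in> {1..m}" "z j = 0" "cum_demand d (t i 1) i - cum_demand d j i \<le> ?Z"
      by blast
    have "i \<in> {1..n}"
      using i ln Sbar(2) by auto
    then show ?thesis
      using PD(6)[OF _ j(1,2), of i] j(3) by linarith
  qed
  \<comment> \<open>\<open>t l 1\<close> is fixed as \<open>\<sigma> l 1\<close>, a scenario of
    maximal demand up to \<open>l\<close>; it dominates the demand of \<open>t (i - 1) 1\<close> up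
    to \<open>l\<close>, hence also that up to \<open>i - 1\<close>.\<close>
  have c0: "0 \<le> ?c i" if "i \<in> Sbar" for i
  proof -
    have il: "1 \<le> i" "i \<le> l"
      using that Sbar(2) by auto
    have top: "cum_demand d j l \<le> cum_demand d (t l 1) l" if "j \<in> {1..m}" for j
      using demand_ordering_first[OF ordl that] assms(12) by simp
    have mono: "cum_demand d j (i - 1) \<le> cum_demand d j l" if "j \<in> {1..m}" for j
      using that assms(2) il ln by (intro cum_demand_mono) auto
    show ?thesis
    proof (cases "i = 1")
      case True
      have "0 \<le> cum_demand d (t l 1) l"
        unfolding cum_demand_def using first_range[of l] ln assms(2) by (intro sum_nonneg) auto
      then show ?thesis
        using True by (simp add: cum_demand_def)
    next
      case False
      then have "t (i - 1) 1 \<in> {1..m}"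
        using first_range[of "i - 1"] il that by simp
      then show ?thesis
        using top mono by force
    qed
  qed
  have y0: "0 \<le> y i" and x01: "x i \<in> {0, 1}" if "i \<in> {1..l}" for i
    using PD(1,2)[of i] that ln by auto
  have production: "(\<Sum>p = 1..s. y p) \<le> sum y S"
    if "s \<le> l" "\<And>i. i \<in> Sbar \<Longrightarrow> i \<le> s \<Longrightarrow> x i = 0" for s
  proof -
    have "(\<Sum>p = 1..s. y p) = sum y (S \<inter> {1..s})"
    proof (rule sum.mono_neutral_right)
      show "\<forall>i\<in>{1..s} - S \<inter> {1..s}. y i = 0"
      proof
        fix i assume "i \<in> {1..s} - S \<inter> {1..s}"
        then have "i \<in> Sbar" "i \<le> s" "i \<in> {1..n}"
          using that(1) ln assms(9) by auto
        then show "y i = 0"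
          using PD(5) that(2) by blast
      qed
    qed auto
    \<comment> \<open>Production in periods of \<open>S\<close> after \<open>s\<close> is
      nonnegative.\<close>
    also have "\<dots> \<le> sum y S"
      using Sbar(5) assms(8) y0 by (intro sum_mono2) (auto simp: subset_iff)
    finally show ?thesis .
  qed
  show "sum y S + (\<Sum>i\<in>Sbar. ?c i * x i) + ?Z \<ge> cum_demand d (t l 1) l"
  proof (cases "\<forall>i\<in>Sbar. x i = 0")
    case True
    then have "(\<Sum>i\<in>Sbar. ?c i * x i) = 0"
      by simp
    then show ?thesis
      using cover[of l] production[of l] True ln by auto
  next
    case False
    \<comment> \<open>\<open>i - 1\<close> is the period \<open>s\<close> of the case where some
      \<open>x\<close>-term survives; it can be 0.\<close>
    define i where "i = (LEAST i. i \<in> Sbar \<and> x i \<noteq> 0)"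
    have i: "i \<in> Sbar" "x i \<noteq> 0"
      unfolding i_def using False LeastI_ex[of "\<lambda>i. i \<in> Sbar \<and> x i \<noteq> 0"] by auto
    have first: "x q = 0" if "q \<in> Sbar" "q \<le> i - 1" for q
      using not_less_Least[of q "\<lambda>i. i \<in> Sbar \<and> x i \<noteq> 0"] that i Sbar(2)
      unfolding i_def[symmetric] by (auto simp: subset_iff Suc_le_eq)
    have il: "1 \<le> i" "i \<le> l" "x i = 1"
      using i x01[of i] Sbar(2) by auto
    have "?c i = ?c i * x i"
      using il by simp
    also have "\<dots> \<le> (\<Sum>i\<in>Sbar. ?c i * x i)"
    proof (rule member_le_sum)
      show "0 \<le> ?c q * x q" if "q \<in> Sbar - {i}" for q
        using c0[of q] x01[of q] that subsetD[OF Sbar(2), of q] by auto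
    qed (use i Sbar in auto)
    finally have first_order: "?c i \<le> (\<Sum>i\<in>Sbar. ?c i * x i)" .
    have "(\<Sum>p = 1..i - 1. y p) \<le> sum y S"
      using production[of "i - 1"] first il by auto
    moreover have "cum_demand d (t (i - 1) 1) (i - 1) \<le> (\<Sum>p = 1..i - 1. y p) + ?Z"
    \<comment> \<open>For \<open>i = 1\<close> demand and production up to period 0 are empty sums,
      and only \<open>0 \<le> ?Z\<close> remains.\<close>
    proof (cases "i = 1")
      case True
      then show ?thesis
        using Z0 by (simp add: cum_demand_def)
    next
      case False
      then show ?thesis
        using cover[of "i - 1"] il i(1) by simp
    qed
    \<comment> \<open>The demand of \<open>t (i - 1) 1\<close> cancels between \<open>?c i\<close>
      and the bound on it by production and \<open>?Z\<close>.\<close>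
    ultimately show ?thesis
      using first_order by linarith
  qed
qed

end
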